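(* Let $L\colon[a,b]\times\mathbb{R}^{n}\times\mathbb{R}^n\to\mathbb{R}^d$ be of class $C^1$. Let $M\subset\mathcal{X}$ be an infimizer for $\overline J$, and suppose that for every $\zeta\in C^+\setminus\{0\}$ there exists a $\zeta$-solution $y_\zeta\in M$. Then for any $v\in C_0^1([a,b];\mathbb{R}^n)$ $$\sup_{\zeta\in C^+\setminus\{0\}}\widehat J'_\zeta(0;M)(v)=C,$$ where the supremum of a family of sets is its intersection.
   Context: Let $a<b$ be real, $n\ge 1$, $d>1$ integers, $A,B\in\mathbb{R}^n$, and let $\emptyset\neq C\subsetneq\mathbb{R}^d$ be a closed convex cone with dual $C^+=\{\zeta\in\mathbb{R}^d\mid \zeta\cdot z\ge 0\ \forall z\in C\}$. Let $\mathcal{F}(\mathbb{R}^d,C)=\{D\subseteq\mathbb{R}^d\mid D=\mathrm{cl}(D+C)\}$, ordered by $\supseteq$ (infimum = closure of the union, supremum = intersection). Put $\mathcal{X}=\{y\in C^1([a,b];\mathbb{R}^n)\mid y(a)=A,\ y(b)=B\}$, $C^1_0([a,b];\mathbb{R}^n)=\{v\in C^1([a,b];\mathbb{R}^n)\mid v(a)=v(b)=0\}$, $J(y)=\int_a^bL(t,y(t),\dot y(t))\,dt\in\mathbb{R}^d$, $\overline J(y)=J(y)+C$, $J_\zeta(y)=\zeta\cdot J(y)$. A set $M\subseteq\mathcal{X}$ is an infimizer for $\overline J$ if $\mathrm{cl}\bigcup_{y\in M}\overline J(y)=\mathrm{cl}\bigcup_{y\in\mathcal{X}}\overline J(y)$.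 A $\zeta$-solution is an arc $y_\zeta\in\mathcal{X}$ with $J_\zeta(y_\zeta)=\inf_{y\in\mathcal{X}}J_\zeta(y)$. The inf-translation of $\overline J$ by $M$ is $\widehat J(v;M)=\mathrm{cl}\bigcup_{y\in M}\overline J(y+v)$ for $v\in C^1_0([a,b];\mathbb{R}^n)$. For $\zeta\in C^+\setminus\{0\}$: $H^+(\zeta)=\{z\in\mathbb{R}^d\mid\zeta\cdot z\ge0\}$; for $D,E\in\mathcal{F}(\mathbb{R}^d,C)$ the $\zeta$-difference is $D-_\zeta E=\{z\in\mathbb{R}^d\mid z+E\subseteq\mathrm{cl}(D+H^+(\zeta))\}$. The directional derivative with respect to $\zeta$ of a set-valued $f$ at $x_0$ in direction $v$ is $f'_\zeta(x_0)(v)=\lim_{s\to0^+}\frac1s\big(f(x_0+sv)-_\zeta f(x_0)\big)$, and $\widehat J'_\zeta(0;M)(v)$ is this derivative for $f=\widehat J(\cdot;M)$, $x_0=0$. Here for a sequence of sets $\lim_{k\to\infty}D_k=\{z\in\mathbb{R}^d\mid \exists z_k\in D_k\ (k\in\mathbb{N}),\ z_k\to z\}$, and $\lim_{s\to0^+}D_s$ is the set equal to $\lim_{k\to\infty}D_{s_k}$ for every sequence $s_k\to0$, $s_k>0$. *)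

theory Defs
  imports "HOL-Analysis.Analysis" "HOL-Library.Set_Algebras"
begin

text \<open>
  Arcs \<open>[a,b] \<rightarrow> \<real>^n\<close> are total functions whose values outside \<open>{a..b}\<close> are
  irrelevant: derivatives are taken within \<open>{a..b}\<close> (one-sided at the endpoints), so
  every notion below depends only on the restriction to \<open>{a..b}\<close>.
\<close>

definition C1_arc :: "real \<Rightarrow> real \<Rightarrow> (real \<Rightarrow> 'a::real_normed_vector) \<Rightarrow> bool" where
  "C1_arc a b y \<longleftrightarrow>
     (\<exists>y'. (\<forall>t\<in>{a..b}. (y has_vector_derivative y' t) (at t within {a..b})) \<and>
           continuous_on {a..b} y')"

definition C1_on :: "'a::real_normed_vector set \<Rightarrow> ('a \<Rightarrow> 'b::real_normed_vector) \<Rightarrow> bool" where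
  "C1_on S f \<longleftrightarrow>
     (\<exists>f' :: 'a \<Rightarrow> 'a \<Rightarrow>\<^sub>L 'b.
        (\<forall>x\<in>S. (f has_derivative blinfun_apply (f' x)) (at x within S)) \<and>
        continuous_on S f')"

definition admissible_arcs ::
    "real \<Rightarrow> real \<Rightarrow> 'a::real_normed_vector \<Rightarrow> 'a \<Rightarrow> (real \<Rightarrow> 'a) set" where
  "admissible_arcs a b A B = {y. C1_arc a b y \<and> y a = A \<and> y b = B}"

definition C1_zero :: "real \<Rightarrow> real \<Rightarrow> (real \<Rightarrow> 'a::real_normed_vector) set" where
  "C1_zero a b = {v. C1_arc a b v \<and> v a = 0 \<and> v b = 0}"

definition dual_cone :: "'a::real_inner set \<Rightarrow> 'a set" where
  "dual_cone C = {\<zeta>. \<forall>z\<in>C. \<zeta> \<bullet> z \<ge> 0}"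

definition Hplus :: "'a::real_inner \<Rightarrow> 'a set" where
  "Hplus \<zeta> = {z. \<zeta> \<bullet> z \<ge> 0}"

definition J ::
    "real \<Rightarrow> real \<Rightarrow> (real \<times> 'a::real_normed_vector \<times> 'a \<Rightarrow> 'b::euclidean_space)
      \<Rightarrow> (real \<Rightarrow> 'a) \<Rightarrow> 'b" where
  "J a b L y = integral {a..b} (\<lambda>t. L (t, y t, vector_derivative y (at t within {a..b})))"

definition Jbar ::
    "real \<Rightarrow> real \<Rightarrow> (real \<times> 'a::real_normed_vector \<times> 'a \<Rightarrow> 'b::euclidean_space)
      \<Rightarrow> 'b set \<Rightarrow> (real \<Rightarrow> 'a) \<Rightarrow> 'b set" where
  "Jbar a b L C y = {J a b L y} + C"

definition infimizer ::
    "real \<Rightarrow> real \<Rightarrow> 'a \<Rightarrow> 'a \<Rightarrow> (real \<times> 'a::real_normed_vector \<times> 'a \<Rightarrow> 'b::euclidean_space)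
      \<Rightarrow> 'b set \<Rightarrow> (real \<Rightarrow> 'a) set \<Rightarrow> bool" where
  "infimizer a b A B L C M \<longleftrightarrow>
     M \<subseteq> admissible_arcs a b A B \<and>
     closure (\<Union>y\<in>M. Jbar a b L C y) = closure (\<Union>y\<in>admissible_arcs a b A B. Jbar a b L C y)"

text \<open>The infimum is taken in the extended reals, since it may be \<open>-\<infinity>\<close>, in which case
  there is no solution.\<close>

definition zeta_solution ::
    "real \<Rightarrow> real \<Rightarrow> 'a \<Rightarrow> 'a \<Rightarrow> (real \<times> 'a::real_normed_vector \<times> 'a \<Rightarrow> 'b::euclidean_space)
      \<Rightarrow> 'b \<Rightarrow> (real \<Rightarrow> 'a) \<Rightarrow> bool" where
  "zeta_solution a b A B L \<zeta> y \<longleftrightarrow>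
     y \<in> admissible_arcs a b A B \<and>
     ereal (\<zeta> \<bullet> J a b L y) = (INF w\<in>admissible_arcs a b A B. ereal (\<zeta> \<bullet> J a b L w))"

definition Jhat ::
    "real \<Rightarrow> real \<Rightarrow> (real \<times> 'a::real_normed_vector \<times> 'a \<Rightarrow> 'b::euclidean_space)
      \<Rightarrow> 'b set \<Rightarrow> (real \<Rightarrow> 'a) set \<Rightarrow> (real \<Rightarrow> 'a) \<Rightarrow> 'b set" where
  "Jhat a b L C M v = closure (\<Union>y\<in>M. Jbar a b L C (\<lambda>t. y t + v t))"

definition zeta_diff :: "'b::real_inner \<Rightarrow> 'b set \<Rightarrow> 'b set \<Rightarrow> 'b set" where
  "zeta_diff \<zeta> D E = {z. {z} + E \<subseteq> closure (D + Hplus \<zeta>)}"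

definition set_lim :: "(nat \<Rightarrow> 'b::topological_space set) \<Rightarrow> 'b set" where
  "set_lim D = {z. \<exists>x. (\<forall>k. x k \<in> D k) \<and> x \<longlonglongrightarrow> z}"

definition has_set_lim_at_right_0 ::
    "(real \<Rightarrow> 'b::topological_space set) \<Rightarrow> 'b set \<Rightarrow> bool" where
  "has_set_lim_at_right_0 D S \<longleftrightarrow>
     (\<forall>s :: nat \<Rightarrow> real. (\<forall>k. s k > 0) \<longrightarrow> s \<longlonglongrightarrow> 0 \<longrightarrow> set_lim (\<lambda>k. D (s k)) = S)"

text \<open>Function types carry no scalar multiplication, so the point \<open>x\<^sub>0 + s v\<close> is written
  pointwise.\<close>

definition has_zeta_derivative ::
    "'b::real_inner \<Rightarrow> ((real \<Rightarrow> 'a::real_vector) \<Rightarrow> 'b set)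
      \<Rightarrow> (real \<Rightarrow> 'a) \<Rightarrow> (real \<Rightarrow> 'a) \<Rightarrow> 'b set \<Rightarrow> bool" where
  "has_zeta_derivative \<zeta> f x0 v S \<longleftrightarrow>
     has_set_lim_at_right_0
       (\<lambda>s. (\<lambda>z. (1 / s) *\<^sub>R z) ` zeta_diff \<zeta> (f (\<lambda>t. x0 t + s *\<^sub>R v t)) (f x0)) S"

text \<open>Meaningful only if the derivative exists; it is then unique.\<close>

definition zeta_derivative ::
    "'b::real_inner \<Rightarrow> ((real \<Rightarrow> 'a::real_vector) \<Rightarrow> 'b set)
      \<Rightarrow> (real \<Rightarrow> 'a) \<Rightarrow> (real \<Rightarrow> 'a) \<Rightarrow> 'b set" where
  "zeta_derivative \<zeta> f x0 v = (THE S. has_zeta_derivative \<zeta> f x0 v S)"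

end

theory Submission
  imports Defs
begin

text \<open>
  Fix \<open>\<zeta>\<close> and let \<open>m s\<close> be the infimum of \<open>\<zeta> \<bullet> J (y + s v)\<close> over \<open>y \<in> M\<close>.  Modulo the
  half-space \<open>H\<^sup>+(\<zeta>)\<close> only \<open>m\<close> is visible: the \<open>\<zeta>\<close>-difference quotient at \<open>s\<close> is the half-space
  \<open>(m s - m 0) / s \<le> \<zeta> \<bullet> z\<close>.  Since \<open>y + s v\<close> is admissible and \<open>M\<close> contains a
  \<open>\<zeta>\<close>-solution \<open>y\<^sub>0\<close>, we have \<open>0 \<le> m s - m 0 \<le> \<zeta> \<bullet> J (y\<^sub>0 + s v) - \<zeta> \<bullet> J y\<^sub>0\<close>, and the right-hand
  side is differentiable in \<open>s\<close> with a minimum at \<open>0\<close>, hence \<open>o(s)\<close>.  So the \<open>\<zeta>\<close>-derivative is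
  \<open>H\<^sup>+(\<zeta>)\<close>, and intersecting over \<open>\<zeta>\<close> gives \<open>C\<close> by the bipolar theorem.
\<close>

section \<open>Half-spaces: closures, differences, set limits and the bipolar theorem\<close>

lemma closure_add_Hplus:
  fixes \<zeta> :: "'b::real_inner"
  assumes "\<zeta> \<noteq> 0"
    and lower: "\<And>x. x \<in> D \<Longrightarrow> m \<le> \<zeta> \<bullet> x"
    and approx: "\<And>r. m < r \<Longrightarrow> \<exists>x\<in>D. \<zeta> \<bullet> x < r"
  shows "closure (D + Hplus \<zeta>) = {z. m \<le> \<zeta> \<bullet> z}"
proof
  have "D + Hplus \<zeta> \<subseteq> {z. m \<le> \<zeta> \<bullet> z}"
    using lower by (force simp: Hplus_def inner_add_right elim!: set_plus_elim)
  then show "closure (D + Hplus \<zeta>) \<subseteq> {z. m \<le> \<zeta> \<bullet> z}"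
    by (simp add: closed_halfspace_ge closure_minimal)
  show "{z. m \<le> \<zeta> \<bullet> z} \<subseteq> closure (D + Hplus \<zeta>)"
  proof (clarsimp simp: closure_approachable)
    fix z and e :: real
    assume z: "m \<le> \<zeta> \<bullet> z" and "e > 0"
    \<comment> \<open>A step of length \<open>e / 2\<close> along \<open>\<zeta>\<close> raises
      \<open>\<zeta> \<bullet> z\<close> strictly, so that \<open>approx\<close> applies even on the
      boundary hyperplane.\<close>
    define x where "x = z + (e / (2 * norm \<zeta>)) *\<^sub>R \<zeta>"
    have "\<zeta> \<bullet> x > \<zeta> \<bullet> z"
      using \<open>e > 0\<close> \<open>\<zeta> \<noteq> 0\<close> by (simp add: x_def inner_add_right)
    then obtain d where d: "d \<in> D" "\<zeta> \<bullet> d < \<zeta> \<bullet> x"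
      using approx[of "\<zeta> \<bullet> x"] z by auto
    then have "d + (x - d) \<in> D + Hplus \<zeta>"
      by (intro set_plus_intro) (auto simp: Hplus_def inner_diff_right)
    moreover have "dist x z < e"
      using \<open>e > 0\<close> \<open>\<zeta> \<noteq> 0\<close> by (simp add: x_def dist_norm)
    ultimately show "\<exists>x\<in>D + Hplus \<zeta>. dist x z < e"
      by auto
  qed
qed

text \<open>\<open>m\<close> and \<open>m'\<close> are the infima of \<open>\<zeta>\<close> over
  \<open>D\<close> and \<open>E\<close>, given as lower bounds that are approached. Translating
  \<open>E\<close> by \<open>z\<close> shifts its infimum to
  \<open>\<zeta> \<bullet> z + m'\<close>, which is then compared with \<open>m\<close>.\<close>

lemma zeta_diff_eq_halfspace:
  fixes \<zeta> :: "'b::real_inner"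
  assumes "\<zeta> \<noteq> 0"
    and "\<And>x. x \<in> D \<Longrightarrow> m \<le> \<zeta> \<bullet> x" and "\<And>r. m < r \<Longrightarrow> \<exists>x\<in>D. \<zeta> \<bullet> x < r"
    and lower: "\<And>x. x \<in> E \<Longrightarrow> m' \<le> \<zeta> \<bullet> x" and approx: "\<And>r. m' < r \<Longrightarrow> \<exists>x\<in>E. \<zeta> \<bullet> x < r"
  shows "zeta_diff \<zeta> D E = {z. m - m' \<le> \<zeta> \<bullet> z}"
proof -
  have "{z} + E \<subseteq> {w. m \<le> \<zeta> \<bullet> w} \<longleftrightarrow> m - m' \<le> \<zeta> \<bullet> z" for z
  proof
    assume sub: "{z} + E \<subseteq> {w. m \<le> \<zeta> \<bullet> w}"
    show "m - m' \<le> \<zeta> \<bullet> z"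
    proof (rule ccontr)
      assume "\<not> m - m' \<le> \<zeta> \<bullet> z"
      then obtain e where e: "e \<in> E" "\<zeta> \<bullet> e < m - \<zeta> \<bullet> z"
        using approx[of "m - \<zeta> \<bullet> z"] by auto
      then have "z + e \<in> {w. m \<le> \<zeta> \<bullet> w}"
        using sub by (blast intro: set_plus_intro)
      then show False
        using e by (simp add: inner_add_right)
    qed
  next
    assume "m - m' \<le> \<zeta> \<bullet> z"
    then show "{z} + E \<subseteq> {w. m \<le> \<zeta> \<bullet> w}"
      using lower by (force simp: inner_add_right elim!: set_plus_elim)
  qed
  then show ?thesis
    by (simp add: zeta_diff_def closure_add_Hplus[OF assms(1-3)])
qed

lemma set_lim_halfspaces:
  fixes \<zeta> :: "'b::real_inner"
  assumes "\<zeta> \<noteq> 0" and c: "c \<longlonglongrightarrow> 0"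
  shows "set_lim (\<lambda>k. {z. c k \<le> \<zeta> \<bullet> z}) = Hplus \<zeta>"
proof (intro equalityI subsetI)
  fix z assume "z \<in> set_lim (\<lambda>k. {z. c k \<le> \<zeta> \<bullet> z})"
  then obtain x where x: "\<And>k. c k \<le> \<zeta> \<bullet> x k" "x \<longlonglongrightarrow> z"
    by (auto simp: set_lim_def)
  have "(\<lambda>k. \<zeta> \<bullet> x k) \<longlonglongrightarrow> \<zeta> \<bullet> z"
    by (intro tendsto_intros x)
  with c have "0 \<le> \<zeta> \<bullet> z"
    using x(1) by (blast intro: LIMSEQ_le)
  then show "z \<in> Hplus \<zeta>"
    by (simp add: Hplus_def)
next
  fix z assume z: "z \<in> Hplus \<zeta>"
  \<comment> \<open>The correction raises the value of \<open>\<zeta>\<close> by exactly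
    \<open>\<bar>c k\<bar>\<close>, which covers either sign of \<open>c k\<close> and vanishes in
    the limit.\<close>
  define x where "x = (\<lambda>k. z + (\<bar>c k\<bar> / (\<zeta> \<bullet> \<zeta>)) *\<^sub>R \<zeta>)"
  have "x \<longlonglongrightarrow> z + (\<bar>0\<bar> / (\<zeta> \<bullet> \<zeta>)) *\<^sub>R \<zeta>"
    unfolding x_def using \<open>\<zeta> \<noteq> 0\<close> by (intro tendsto_intros c) simp
  moreover have "c k \<le> \<zeta> \<bullet> x k" for k
    using z \<open>\<zeta> \<noteq> 0\<close> by (simp add: x_def Hplus_def inner_add_right)
  ultimately show "z \<in> set_lim (\<lambda>k. {z. c k \<le> \<zeta> \<bullet> z})"
    by (auto simp: set_lim_def)
qed

text \<open>A single positive null sequence already determines the limit. This justifies the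
  definite description in \<open>zeta_derivative\<close>.\<close>

lemma has_set_lim_at_right_0_unique:
  assumes "has_set_lim_at_right_0 D S" and "has_set_lim_at_right_0 D T"
  shows "S = T"
proof -
  have "(\<lambda>k. inverse (real (Suc k))) \<longlonglongrightarrow> 0"
    by (rule LIMSEQ_inverse_real_of_nat)
  moreover have "\<forall>k. inverse (real (Suc k)) > 0"
    by simp
  ultimately show ?thesis
    using assms unfolding has_set_lim_at_right_0_def by metis
qed

text \<open>Bipolar theorem: a point outside \<open>C\<close> is strictly separated from it, and
  invariance under scaling turns the separating functional \<open>p\<close> into a nonzero element
  of the dual cone.\<close>

lemma Inter_Hplus_dual_cone:
  fixes C :: "'b::euclidean_space set"
  assumes "closed C" and "convex C" and "cone C" and "C \<noteq> {}"
  shows "(\<Inter>\<zeta>\<in>dual_cone C - {0}. Hplus \<zeta>) = C"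
proof
  show "C \<subseteq> (\<Inter>\<zeta>\<in>dual_cone C - {0}. Hplus \<zeta>)"
    by (auto simp: dual_cone_def Hplus_def)
  show "(\<Inter>\<zeta>\<in>dual_cone C - {0}. Hplus \<zeta>) \<subseteq> C"
  proof (rule ccontr)
    assume "\<not> ?thesis"
    then obtain z where z: "z \<in> (\<Inter>\<zeta>\<in>dual_cone C - {0}. Hplus \<zeta>)" "z \<notin> C"
      by auto
    obtain p \<beta> where p: "p \<bullet> z < \<beta>" "\<And>x. x \<in> C \<Longrightarrow> \<beta> < p \<bullet> x"
      using separating_hyperplane_closed_point[of C z] assms z by auto
    have "0 \<in> C"
      using assms by (simp add: cone_contains_0)
    then have "\<beta> < 0"
      using p(2) by force
    have "0 \<le> p \<bullet> x" if "x \<in> C" for x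
    proof (rule ccontr)
      assume "\<not> 0 \<le> p \<bullet> x"
      \<comment> \<open>If \<open>p\<close> were negative at \<open>x\<close>, the ray through
        \<open>x\<close> would contain a point of \<open>C\<close> where \<open>p\<close> is exactly
        \<open>\<beta>\<close>, against strict separation.\<close>
      then have "(\<beta> / (p \<bullet> x)) *\<^sub>R x \<in> C"
        using \<open>\<beta> < 0\<close> \<open>x \<in> C\<close> \<open>cone C\<close> by (simp add: cone_def divide_nonpos_neg)
      from p(2)[OF this] \<open>\<not> 0 \<le> p \<bullet> x\<close> show False
        by simp
    qed
    then have "p \<in> dual_cone C - {0}"
      using p(1) \<open>\<beta> < 0\<close> by (auto simp: dual_cone_def)
    then show False
      using z(1) p(1) \<open>\<beta> < 0\<close> by (force simp: Hplus_def)
  qed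
qed

section \<open>Variations of arcs and the first variation of \<open>J\<close>\<close>

lemma C1_arc_variation:
  assumes "C1_arc a b y" and "C1_arc a b v"
  shows "C1_arc a b (\<lambda>t. y t + s *\<^sub>R v t)"
proof -
  from assms obtain y' v' where
    "\<And>t. t \<in> {a..b} \<Longrightarrow> (y has_vector_derivative y' t) (at t within {a..b})"
    "continuous_on {a..b} y'"
    "\<And>t. t \<in> {a..b} \<Longrightarrow> (v has_vector_derivative v' t) (at t within {a..b})"
    "continuous_on {a..b} v'"
    unfolding C1_arc_def by blast
  then show ?thesis
    unfolding C1_arc_def
    by (intro exI[of _ "\<lambda>t. y' t + s *\<^sub>R v' t"]) (auto intro!: derivative_eq_intros continuous_intros)
qed

text \<open>Differentiation under the integral sign: the integrand has an
  \<open>s\<close>-derivative that is jointly continuous in \<open>s\<close> and \<open>t\<close>.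
  The value of \<open>D\<close> may stay open, since minimality later forces
  \<open>\<zeta> \<bullet> D = 0\<close>.\<close>

lemma J_variation_differentiable:
  fixes L :: "real \<times> 'a::real_normed_vector \<times> 'a \<Rightarrow> 'b::euclidean_space"
  assumes "a < b" and L: "C1_on ({a..b} \<times> UNIV \<times> UNIV) L"
    and "C1_arc a b y" and "C1_arc a b v"
  shows "\<exists>D. ((\<lambda>s. J a b L (\<lambda>t. y t + s *\<^sub>R v t)) has_vector_derivative D) (at 0)"
proof -
  let ?S = "{a..b} \<times> (UNIV :: 'a set) \<times> (UNIV :: 'a set)"
  obtain L' where L': "\<And>x. x \<in> ?S \<Longrightarrow> (L has_derivative blinfun_apply (L' x)) (at x within ?S)"
    and L'_cont: "continuous_on ?S L'"
    using L unfolding C1_on_def by blast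
  have L_cont: "continuous_on ?S L"
    using L' by (rule has_derivative_continuous_on)
  obtain y' where y': "\<And>t. t \<in> {a..b} \<Longrightarrow> (y has_vector_derivative y' t) (at t within {a..b})"
    and y'_cont: "continuous_on {a..b} y'"
    using assms(3) unfolding C1_arc_def by blast
  obtain v' where v': "\<And>t. t \<in> {a..b} \<Longrightarrow> (v has_vector_derivative v' t) (at t within {a..b})"
    and v'_cont: "continuous_on {a..b} v'"
    using assms(4) unfolding C1_arc_def by blast
  have y_cont: "continuous_on {a..b} y" and v_cont: "continuous_on {a..b} v"
    using continuous_on_vector_derivative[OF y'] continuous_on_vector_derivative[OF v'] by auto
  define p where "p = (\<lambda>s t. (t, y t + s *\<^sub>R v t, y' t + s *\<^sub>R v' t))"
  have J_eq: "J a b L (\<lambda>t. y t + s *\<^sub>R v t) = integral (cbox a b) (\<lambda>t. L (p s t))" for s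
    unfolding J_def cbox_interval
  proof (rule integral_cong)
    fix t assume t: "t \<in> {a..b}"
    have "((\<lambda>t. y t + s *\<^sub>R v t) has_vector_derivative y' t + s *\<^sub>R v' t) (at t within {a..b})"
      using y'[OF t] v'[OF t] by (auto intro!: derivative_eq_intros)
    \<comment> \<open>\<open>a < b\<close> makes one-sided derivatives unique at the endpoints as
      well.\<close>
    then have "vector_derivative (\<lambda>t. y t + s *\<^sub>R v t) (at t within {a..b}) = y' t + s *\<^sub>R v' t"
      using vector_derivative_within_cbox[OF \<open>a < b\<close>] t by (simp add: cbox_interval)
    then show "L (t, y t + s *\<^sub>R v t, vector_derivative (\<lambda>t. y t + s *\<^sub>R v t) (at t within {a..b}))
        = L (p s t)"
      by (simp add: p_def)
  qed
  have p_cont: "continuous_on (UNIV \<times> cbox a b) (\<lambda>(s, t). p s t)"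
    unfolding p_def split_beta cbox_interval
    by (intro continuous_intros continuous_on_compose2[OF y_cont] continuous_on_compose2[OF v_cont]
        continuous_on_compose2[OF y'_cont] continuous_on_compose2[OF v'_cont]) auto
  have "((\<lambda>s. integral (cbox a b) (\<lambda>t. L (p s t))) has_vector_derivative
      integral (cbox a b) (\<lambda>t. L' (p 0 t) (0, v t, v' t))) (at 0 within UNIV)"
  proof (rule leibniz_rule_vector_derivative[where fx = "\<lambda>s t. L' (p s t) (0, v t, v' t)"])
    fix s t :: real
    assume t: "t \<in> cbox a b"
    have "((\<lambda>s. p s t) has_derivative (\<lambda>h. h *\<^sub>R (0, v t, v' t))) (at s)"
      unfolding p_def by (auto intro!: derivative_eq_intros)
    \<comment> \<open>\<open>L\<close> is differentiable only within \<open>?S\<close>; for fixed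
      \<open>t\<close> the curve \<open>p s t\<close> stays in \<open>?S\<close> for all real
      \<open>s\<close>, so the chain rule yields a full derivative in \<open>s\<close>.\<close>
    moreover have "range (\<lambda>s. p s t) \<subseteq> ?S"
      using t by (auto simp: p_def)
    ultimately have "((\<lambda>s. L (p s t)) has_derivative (\<lambda>h. L' (p s t) (h *\<^sub>R (0, v t, v' t)))) (at s)"
      using has_derivative_in_compose2[OF L'] by blast
    then show "((\<lambda>s. L (p s t)) has_vector_derivative L' (p s t) (0, v t, v' t)) (at s within UNIV)"
      by (simp add: has_vector_derivative_def blinfun.scaleR_right del: scaleR_Pair)
  next
    fix s
    have "continuous_on (cbox a b) (p s)"
      using continuous_on_compose2[OF p_cont, of "cbox a b" "Pair s"]
      by (simp add: continuous_on_Pair image_subset_iff)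
    then have "continuous_on (cbox a b) (\<lambda>t. L (p s t))"
      by (rule continuous_on_compose2[OF L_cont]) (auto simp: p_def)
    then show "(\<lambda>t. L (p s t)) integrable_on cbox a b"
      by (rule integrable_continuous)
  next
    have "continuous_on (UNIV \<times> cbox a b) (\<lambda>x. L' (case x of (s, t) \<Rightarrow> p s t))"
      by (rule continuous_on_compose2[OF L'_cont p_cont]) (auto simp: p_def)
    then show "continuous_on (UNIV \<times> cbox a b) (\<lambda>(s, t). L' (p s t) (0, v t, v' t))"
      unfolding split_beta cbox_interval
      by (intro continuous_intros continuous_on_compose2[OF v_cont]
          continuous_on_compose2[OF v'_cont]) auto
  qed auto
  then show ?thesis
    unfolding J_eq by auto
qed

section \<open>The \<open>\<zeta>\<close>-derivative of the inf-translation\<close>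

lemma zeta_solution_le:
  assumes "zeta_solution a b A B L \<zeta> y" and "w \<in> admissible_arcs a b A B"
  shows "\<zeta> \<bullet> J a b L y \<le> \<zeta> \<bullet> J a b L w"
proof -
  have "ereal (\<zeta> \<bullet> J a b L y) \<le> ereal (\<zeta> \<bullet> J a b L w)"
    using assms unfolding zeta_solution_def by (metis INF_lower)
  then show ?thesis
    by simp
qed

lemma admissible_variation:
  assumes "y \<in> admissible_arcs a b A B" and "v \<in> C1_zero a b"
  shows "(\<lambda>t. y t + s *\<^sub>R v t) \<in> admissible_arcs a b A B"
  using assms by (simp add: admissible_arcs_def C1_zero_def C1_arc_variation)

lemma has_zeta_derivative_Jhat:
  fixes L :: "real \<times> 'a::real_normed_vector \<times> 'a \<Rightarrow> 'b::euclidean_space"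
  assumes "a < b" and "cone C" and "C \<noteq> {}"
    and L: "C1_on ({a..b} \<times> UNIV \<times> UNIV) L"
    and M: "M \<subseteq> admissible_arcs a b A B"
    and \<zeta>: "\<zeta> \<in> dual_cone C - {0}"
    and y0: "y0 \<in> M" "zeta_solution a b A B L \<zeta> y0"
    and v: "v \<in> C1_zero a b"
  shows "has_zeta_derivative \<zeta> (Jhat a b L C M) (\<lambda>_. 0) v (Hplus \<zeta>)"
proof -
  define F where "F = (\<lambda>y s. \<zeta> \<bullet> J a b L (\<lambda>t. y t + s *\<^sub>R v t))"
  define m where "m = (\<lambda>s. INF y\<in>M. F y s)"
  have F_ge: "F y0 0 \<le> F y s" if "y \<in> M" for y s
    using zeta_solution_le[OF y0(2) admissible_variation[OF _ v]] that M by (auto simp: F_def)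
  \<comment> \<open>Boundedness below, with \<open>y0 \<in> M\<close>, makes the real-valued
    \<open>INF\<close> in \<open>m\<close> a genuine infimum.\<close>
  have bdd: "bdd_below ((\<lambda>y. F y s) ` M)" for s
    using F_ge by (rule bdd_belowI2)
  have m_lower: "m s \<le> F y s" if "y \<in> M" for y s
    unfolding m_def using bdd that by (rule cINF_lower)
  have m_ge: "F y0 0 \<le> m s" for s
    unfolding m_def using y0(1) F_ge by (intro cINF_greatest) auto
  have m_0: "m 0 = F y0 0"
    using m_ge m_lower[OF y0(1)] by (rule antisym[rotated])
  have Jhat_lower: "m s \<le> \<zeta> \<bullet> x" if "x \<in> Jhat a b L C M (\<lambda>t. s *\<^sub>R v t)" for x s
  proof -
    have "(\<Union>y\<in>M. Jbar a b L C (\<lambda>t. y t + s *\<^sub>R v t)) \<subseteq> {x. m s \<le> \<zeta> \<bullet> x}"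
    proof clarify
      fix y x assume "y \<in> M" and "x \<in> Jbar a b L C (\<lambda>t. y t + s *\<^sub>R v t)"
      then obtain c where "c \<in> C" and "x = J a b L (\<lambda>t. y t + s *\<^sub>R v t) + c"
        by (auto simp: Jbar_def elim!: set_plus_elim)
      moreover from \<open>c \<in> C\<close> \<zeta> have "0 \<le> \<zeta> \<bullet> c"
        by (auto simp: dual_cone_def)
      ultimately show "m s \<le> \<zeta> \<bullet> x"
        using m_lower[OF \<open>y \<in> M\<close>, of s] by (simp add: F_def inner_add_right)
    qed
    then show ?thesis
      using that closure_minimal[OF _ closed_halfspace_ge] unfolding Jhat_def by blast
  qed
  have Jhat_approx: "\<exists>x\<in>Jhat a b L C M (\<lambda>t. s *\<^sub>R v t). \<zeta> \<bullet> x < r" if "m s < r" for s r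
  proof -
    have "\<exists>y\<in>M. F y s < r"
      using that cINF_less_iff[OF _ bdd, of s r] y0(1) unfolding m_def by blast
    then obtain y where y: "y \<in> M" "F y s < r"
      by blast
    \<comment> \<open>With \<open>0 \<in> C\<close> the value \<open>J (y + s v)\<close> itself lies
      in \<open>Jhat\<close>, so elements of \<open>C\<close> do not raise the infimum above
      \<open>m s\<close>.\<close>
    have "0 \<in> C"
      using assms by (simp add: cone_contains_0)
    then have "J a b L (\<lambda>t. y t + s *\<^sub>R v t) + 0 \<in> Jbar a b L C (\<lambda>t. y t + s *\<^sub>R v t)"
      unfolding Jbar_def by (intro set_plus_intro) auto
    then have "J a b L (\<lambda>t. y t + s *\<^sub>R v t) \<in> Jhat a b L C M (\<lambda>t. s *\<^sub>R v t)"
      unfolding Jhat_def using y(1) closure_subset by fastforce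
    then show ?thesis
      using y(2) by (auto simp: F_def)
  qed
  have diff_eq: "zeta_diff \<zeta> (Jhat a b L C M (\<lambda>t. s *\<^sub>R v t)) (Jhat a b L C M (\<lambda>_. 0))
      = {z. m s - m 0 \<le> \<zeta> \<bullet> z}" for s
    using \<zeta> Jhat_lower Jhat_approx Jhat_lower[where s = 0] Jhat_approx[where s = 0]
    by (intro zeta_diff_eq_halfspace) auto
  have image_eq: "(\<lambda>z. (1 / s) *\<^sub>R z) ` {z. c \<le> \<zeta> \<bullet> z} = {z. c / s \<le> \<zeta> \<bullet> z}"
    if "s > 0" for s c
  proof (intro equalityI subsetI)
    fix z assume "z \<in> {z. c / s \<le> \<zeta> \<bullet> z}"
    then have "s *\<^sub>R z \<in> {z. c \<le> \<zeta> \<bullet> z}" and "z = (1 / s) *\<^sub>R (s *\<^sub>R z)"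
      using that by (auto simp: field_simps)
    then show "z \<in> (\<lambda>z. (1 / s) *\<^sub>R z) ` {z. c \<le> \<zeta> \<bullet> z}"
      by blast
  qed (use that in \<open>auto simp: divide_right_mono\<close>)
  obtain D where D: "((\<lambda>s. J a b L (\<lambda>t. y0 t + s *\<^sub>R v t)) has_vector_derivative D) (at 0)"
    using J_variation_differentiable[OF \<open>a < b\<close> L, of y0 v] M y0(1) v
    by (auto simp: admissible_arcs_def C1_zero_def)
  have "(F y0 has_vector_derivative \<zeta> \<bullet> D) (at 0)"
    unfolding F_def by (rule bounded_linear.has_vector_derivative[OF bounded_linear_inner_right D])
  then have F_deriv: "DERIV (F y0) 0 :> \<zeta> \<bullet> D"
    by (simp add: has_real_derivative_iff_has_vector_derivative)
  \<comment> \<open>By \<open>F_ge\<close> the function \<open>F y0\<close> has a global minimum at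
    \<open>0\<close>; the radius \<open>1\<close> is arbitrary.\<close>
  then have "\<zeta> \<bullet> D = 0"
    using F_ge[OF y0(1)] by (intro DERIV_local_min[OF F_deriv, of 1]) auto
  with F_deriv have F_lim: "(\<lambda>s. (F y0 s - F y0 0) / s) \<midarrow>0\<rightarrow> 0"
    by (simp add: DERIV_def)
  show ?thesis
    unfolding has_zeta_derivative_def has_set_lim_at_right_0_def
  proof (intro allI impI)
    fix s :: "nat \<Rightarrow> real"
    assume s: "\<forall>k. s k > 0" "s \<longlonglongrightarrow> 0"
    have "(\<lambda>k. (F y0 (s k) - F y0 0) / s k) \<longlonglongrightarrow> 0"
      using s by (intro tendsto_compose_eventually[OF F_lim]) (auto simp: less_imp_neq[symmetric])
    \<comment> \<open>Squeeze: \<open>m_ge\<close> bounds the quotient below by \<open>0\<close>,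
      and \<open>m_lower\<close> at \<open>y0\<close> bounds it above by the quotient of
      \<open>F y0\<close>.\<close>
    then have "(\<lambda>k. (m (s k) - m 0) / s k) \<longlonglongrightarrow> 0"
      by (rule tendsto_sandwich[OF _ _ tendsto_const, rotated 2])
         (use s m_ge m_lower[OF y0(1)] in \<open>auto simp: m_0 divide_right_mono less_imp_le\<close>)
    then have "set_lim (\<lambda>k. {z. (m (s k) - m 0) / s k \<le> \<zeta> \<bullet> z}) = Hplus \<zeta>"
      using \<zeta> by (intro set_lim_halfspaces) auto
    then show "set_lim (\<lambda>k. (\<lambda>z. (1 / s k) *\<^sub>R z) ` zeta_diff \<zeta>
        (Jhat a b L C M (\<lambda>t. 0 + s k *\<^sub>R v t)) (Jhat a b L C M (\<lambda>_. 0))) = Hplus \<zeta>"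
      using s by (simp add: diff_eq image_eq)
  qed
qed

theorem mainTheorem6:
  fixes a b :: real
    and A B :: "real ^ 'n"
    and C :: "(real ^ 'd) set"
    and L :: "real \<times> (real ^ 'n) \<times> (real ^ 'n) \<Rightarrow> real ^ 'd"
    and M :: "(real \<Rightarrow> real ^ 'n) set"
    and v :: "real \<Rightarrow> real ^ 'n"
  assumes "a < b"
    and "CARD('d) > 1"
    and "closed C" and "convex C" and "cone C" and "C \<noteq> {}" and "C \<noteq> UNIV"
    and "C1_on ({a..b} \<times> UNIV \<times> UNIV) L"
    and "infimizer a b A B L C M"
    and "\<forall>\<zeta> \<in> dual_cone C - {0}. \<exists>y \<in> M. zeta_solution a b A B L \<zeta> y"
    and "v \<in> C1_zero a b"
  shows "(\<forall>\<zeta> \<in> dual_cone C - {0}. \<exists>S. has_zeta_derivative \<zeta> (Jhat a b L C M) (\<lambda>_. 0) v S) \<and>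
    (\<Inter>\<zeta> \<in> dual_cone C - {0}. zeta_derivative \<zeta> (Jhat a b L C M) (\<lambda>_. 0) v) = C"
proof -
  have deriv: "has_zeta_derivative \<zeta> (Jhat a b L C M) (\<lambda>_. 0) v (Hplus \<zeta>)"
    if "\<zeta> \<in> dual_cone C - {0}" for \<zeta>
    using assms that has_zeta_derivative_Jhat unfolding infimizer_def by blast
  \<comment> \<open>Existence from \<open>deriv\<close> and uniqueness of the limit identify the
    definite description with \<open>Hplus \<zeta>\<close>, which leaves the bipolar
    identity.\<close>
  have "zeta_derivative \<zeta> (Jhat a b L C M) (\<lambda>_. 0) v = Hplus \<zeta>"
    if "\<zeta> \<in> dual_cone C - {0}" for \<zeta>
    unfolding zeta_derivative_def using deriv[OF that]
    by (rule the_equality)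
       (use deriv[OF that] has_set_lim_at_right_0_unique in \<open>unfold has_zeta_derivative_def, blast\<close>)
  then show ?thesis
    using deriv Inter_Hplus_dual_cone[OF assms(3-6)] by (metis (no_types, lifting) INF_cong)
qed

end
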